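(* Let $f:\operatorname{dom}f\to\mathbb{R}$ be a piecewise linear-quadratic function on a polyhedral set $\operatorname{dom}f\subseteq\mathbb{R}^n$ that is the union of finitely many polyhedra $\{P^i\}_{i=1}^I$; on each polyhedral piece $P^i$ there is a quadratic function $q_i$ such that $f(x)=q_i(x)$ for all $x\in P^i$. Then there exist finitely many functions $\{f_{ik}\}_{k=1}^{K_i}$, for $i=1,\dots,I$, each given by $$f_{ik}(x)=\sum_{j=1}^{J_{ik}^+}f_{ikj}^+(x)-\sum_{j=1}^{J_{ik}^-}f_{ikj}^-(x),\qquad k=1,\dots,K_i,$$ where each $f_{ikj}^{\pm}\in\mathcal{F}$, such that $$f(x)=\min_{1\le i\le I}\Big[\,q_i(x)+\max_{1\le k\le K_i}f_{ik}(x)\Big]\qquad\text{for all }x\in\operatorname{dom}f,$$ and, for each $i$, the zero set of the function $\widehat\phi_i(x)\triangleq\max_{1\le k\le K_i}f_{ik}(x)$ coincides with $P^i$.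
   Context: A continuous function $f:\mathcal{D}\to\mathbb{R}$, $\mathcal{D}\subseteq\mathbb{R}^n$, is piecewise linear-quadratic (PLQ) if there are finitely many quadratic functions $q_1,\dots,q_I$ (polynomials of degree at most 2) and polyhedra $P^1,\dots,P^I$ with union $\mathcal{D}$ such that $f=q_i$ on $P^i$; $\mathcal{D}$ is denoted $\operatorname{dom}f$. $\mathcal{F}$ is the family of functions on $\mathbb{R}^n$ consisting of all squares of affine functions, $x\mapsto(a^Tx+\alpha)^2$, and all squares of plus-composite-affine functions, $x\mapsto[\max(a^Tx+\alpha,0)]^2$, with $a\in\mathbb{R}^n$, $\alpha\in\mathbb{R}$. *)

theory Defs
  imports "HOL-Analysis.Analysis"
begin

text \<open>Polynomials of degree at most 2. The matrix need not be symmetric; this does not change the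
  class of functions.\<close>

definition quadratic_fun :: "(real ^ 'n \<Rightarrow> real) \<Rightarrow> bool" where
  "quadratic_fun q \<longleftrightarrow>
     (\<exists>(A :: real ^ 'n ^ 'n) (b :: real ^ 'n) c. \<forall>x. q x = x \<bullet> (A *v x) + b \<bullet> x + c)"

text \<open>A function \<open>D \<rightarrow> \<real>\<close> is a total HOL function of which only the values on \<open>D\<close> matter.\<close>

definition plq_on :: "(real ^ 'n) set \<Rightarrow> (real ^ 'n \<Rightarrow> real) \<Rightarrow> bool" where
  "plq_on D f \<longleftrightarrow> continuous_on D f \<and>
     (\<exists>(I :: nat) P q. D = (\<Union>i\<in>{1..I}. P i) \<and>
        (\<forall>i\<in>{1..I}. polyhedron (P i) \<and> quadratic_fun (q i) \<and> (\<forall>x\<in>P i. f x = q i x)))"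

definition sq_affine_family :: "(real ^ 'n \<Rightarrow> real) set" where
  "sq_affine_family =
     {\<lambda>x. (a \<bullet> x + \<alpha>)\<^sup>2 | a \<alpha>. True} \<union> {\<lambda>x. (max (a \<bullet> x + \<alpha>) 0)\<^sup>2 | a \<alpha>. True}"

end

theory Submission imports Defs begin

text \<open>Write \<open>P i = {x. \<forall>(a, b)\<in>A. a \<bullet> x \<le> b}\<close> with \<open>A\<close> finite. A continuous PLQ function is
  Lipschitz along segments with a constant growing like \<open>1 + norm x\<close>, so by Hoffman's error bound
  \<open>f - q i\<close> is bounded on \<open>D\<close> by \<open>L * (1 + norm x) * l\<close> plus a multiple of \<open>l\<^sup>2\<close>, where
  \<open>l = a \<bullet> x - b\<close> is some violated constraint. For \<open>l \<le> 0\<close> and any affine \<open>u\<close> the function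
  \<open>(max (u + M * l) 0)\<^sup>2 - (max u 0)\<^sup>2\<close> is nonpositive, while for \<open>l > 0\<close> and \<open>u > 0\<close> it equals
  \<open>2 * M * u * l + M\<^sup>2 * l\<^sup>2\<close>. Letting \<open>u\<close> range over \<open>1 \<plusminus> x $ k\<close> and \<open>l\<close> over the constraints, the
  maximum of these functions and \<open>0\<close> vanishes exactly on \<open>P i\<close> and dominates \<open>f - q i\<close> once \<open>M\<close> is
  large. An empty \<open>P i\<close> is treated with the squares \<open>(max (M * u) 0)\<^sup>2\<close> alone.\<close>

section \<open>Hoffman's error bound and inequality systems of polyhedra\<close>

text \<open>Minimise \<open>h y + e * norm (x - y)\<close> over all \<open>y\<close>, where \<open>h\<close> is the largest violation. At a
  minimiser outside the polyhedron the active constraints admit a common descent direction (towards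
  any feasible point); only finitely many active sets occur, so the descent rate is bounded below
  independently of \<open>x\<close>, which is impossible for small \<open>e\<close>.\<close>

lemma Hoffman_error_bound:
  fixes A :: "('a::euclidean_space \<times> real) set"
  assumes fin: "finite A" and z: "\<And>a b. (a, b) \<in> A \<Longrightarrow> a \<bullet> z \<le> b"
  obtains C where "C > 0"
    "\<And>x. \<exists>(a, b)\<in>A. a \<bullet> x > b \<Longrightarrow>
       \<exists>y. (\<forall>(a, b)\<in>A. a \<bullet> y \<le> b) \<and> (\<exists>(a, b)\<in>A. norm (x - y) \<le> C * (a \<bullet> x - b))"
proof -
  \<comment> \<open>The inserted 0 makes \<open>h\<close> vanish exactly at feasible points and
    keeps \<open>Max\<close> meaningful for empty \<open>A\<close>.\<close>
  define h where "h x = Max (insert 0 ((\<lambda>(a, b). a \<bullet> x - b) ` A))" for x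
  have h_ge: "a \<bullet> x - b \<le> h x" if "(a, b) \<in> A" for a b x
    unfolding h_def using fin that by (intro Max_ge) (auto intro!: image_eqI[where x="(a, b)"])
  have h0: "0 \<le> h x" for x
    unfolding h_def using fin by (intro Max_ge) auto
  have h_le: "h x \<le> m" if "0 \<le> m" "\<And>a b. (a, b) \<in> A \<Longrightarrow> a \<bullet> x - b \<le> m" for x m
    unfolding h_def using fin that by (subst Max_le_iff) auto
  have h_attain: "\<exists>(a, b)\<in>A. h x = a \<bullet> x - b" if "h x > 0" for x
  proof -
    have "h x \<in> insert 0 ((\<lambda>(a, b). a \<bullet> x - b) ` A)"
      unfolding h_def using fin by (intro Max_in) auto
    with that show ?thesis by auto
  qed
  have cont: "continuous_on UNIV h"
    unfolding h_def using fin
  proof (induction A rule: finite_induct)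
    case (insert p B)
    have eq: "Max (insert 0 ((\<lambda>(a, b). a \<bullet> x - b) ` insert p B))
        = max (fst p \<bullet> x - snd p) (Max (insert 0 ((\<lambda>(a, b). a \<bullet> x - b) ` B)))" for x
    proof -
      have "insert 0 ((\<lambda>(a, b). a \<bullet> x - b) ` insert p B)
          = insert (fst p \<bullet> x - snd p) (insert 0 ((\<lambda>(a, b). a \<bullet> x - b) ` B))"
        by (auto simp: case_prod_beta)
      then show ?thesis using insert.hyps(1) by (simp only:) (rule Max_insert, auto)
    qed
    show ?case unfolding eq using insert.IH by (intro continuous_intros)
  qed auto
  define descent where "descent S d r \<longleftrightarrow> norm d = 1 \<and> r > 0 \<and> (\<forall>(a, b)\<in>S. a \<bullet> d \<le> - r)"
    for S :: "('a \<times> real) set" and d and r :: real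
  \<comment> \<open>The chosen rate depends on the set \<open>S\<close> alone, not on the point
    where \<open>S\<close> is active. The default 1 keeps it positive on every \<open>S\<close>, so
    the minimum \<open>c\<close> over the finite set \<open>Pow A\<close> is positive.\<close>
  define rate where "rate S = (if \<exists>r d. descent S d r then SOME r. \<exists>d. descent S d r else 1)" for S
  have rate_pos: "rate S > 0" for S
  proof (cases "\<exists>r d. descent S d r")
    case True
    then have "\<exists>d. descent S d (rate S)"
      unfolding rate_def by (simp only: if_True) (rule someI_ex)
    then show ?thesis unfolding descent_def by blast
  qed (simp add: rate_def)
  have rate: "\<exists>d. descent S d (rate S)" if "descent S d r" for S d r
  proof -
    from that have ex: "\<exists>r d. descent S d r" by blast
    then show ?thesis unfolding rate_def by (simp only: if_True) (rule someI_ex)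
  qed
  define c where "c = Min (rate ` Pow A)"
  have c_pos: "c > 0" unfolding c_def using fin rate_pos by (subst Min_gr_iff) auto
  have c_le: "c \<le> rate S" if "S \<subseteq> A" for S
    unfolding c_def using fin that by (intro Min_le) auto
  \<comment> \<open>Any positive \<open>e\<close> strictly below \<open>c\<close> would do: the
    contradiction will be \<open>c * t \<le> e * t\<close>.\<close>
  define e where "e = c / 2"
  have e: "e > 0" "e < c" using c_pos by (auto simp: e_def)
  have main: "\<exists>y. h y = 0 \<and> norm (x - y) \<le> h x / e" for x
  proof -
    let ?F = "\<lambda>y. h y + e * norm (x - y)"
    have xin: "x \<in> cball x (h x / e)" using h0[of x] e by simp
    have "continuous_on (cball x (h x / e)) ?F"
      using cont by (intro continuous_intros) (auto intro: continuous_on_subset)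
    then obtain y where y: "y \<in> cball x (h x / e)"
      and ymin: "\<And>w. w \<in> cball x (h x / e) \<Longrightarrow> ?F y \<le> ?F w"
      using continuous_attains_inf[of "cball x (h x / e)" ?F] xin by auto
    \<comment> \<open>The ball provides compactness. Outside it the term
      \<open>e * norm (x - w)\<close> alone exceeds \<open>h x\<close>, the value of the objective
      at \<open>x\<close>, so the minimum is global.\<close>
    have glob: "?F y \<le> ?F w" for w
    proof (cases "w \<in> cball x (h x / e)")
      case False
      then have "h x < e * norm (x - w)" using e by (simp add: dist_norm field_simps)
      with ymin[OF xin] h0[of w] show ?thesis by simp
    qed (rule ymin)
    have "h y = 0"
    proof (rule ccontr)
      assume "h y \<noteq> 0"
      with h0[of y] have hy: "h y > 0" by simp
      define S where "S = {(a, b). (a, b) \<in> A \<and> a \<bullet> y - b = h y}"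
      have SA: "S \<subseteq> A" by (auto simp: S_def)
      have finS: "finite S" using SA fin finite_subset by blast
      have zy: "z \<noteq> y"
        using h_attain[OF hy] z hy by force
      \<comment> \<open>An active constraint drops by at least \<open>h y\<close> on the way from
        \<open>y\<close> to the feasible point \<open>z\<close>. The resulting rate
        \<open>r0\<close> depends on \<open>y\<close>; it only serves to show that \<open>S\<close>
        has a descent direction, which is then replaced by one of rate
        \<open>rate S\<close>.\<close>
      define d0 where "d0 = (z - y) /\<^sub>R norm (z - y)"
      define r0 where "r0 = h y / norm (z - y)"
      have "a \<bullet> d0 \<le> - r0" if "(a, b) \<in> S" for a b
      proof -
        have "a \<bullet> (z - y) \<le> - h y"
          using that z[of a b] by (auto simp: S_def inner_diff_right)
        then show ?thesis using zy
          by (simp add: d0_def r0_def divide_simps)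
      qed
      then have "descent S d0 r0"
        unfolding descent_def using zy hy by (auto simp: d0_def r0_def)
      then obtain d where d: "descent S d (rate S)" using rate by blast
      define r where "r = rate S"
      have rc: "c \<le> r" unfolding r_def using c_le[OF SA] .
      have nd: "norm d = 1" and dS: "\<And>a b. (a, b) \<in> S \<Longrightarrow> a \<bullet> d \<le> - c"
        using d rc by (force simp: descent_def r_def)+
      \<comment> \<open>Active constraints decrease at rate \<open>c\<close> for every t > 0;
        inactive ones have slack at t = 0, which persists for small t by continuity.\<close>
      have ev: "eventually (\<lambda>t. a \<bullet> (y + t *\<^sub>R d) - b \<le> h y - c * t) (at_right 0)"
        if ab: "(a, b) \<in> A" for a b
      proof (cases "(a, b) \<in> S")
        case True
        then have "a \<bullet> (y + t *\<^sub>R d) - b \<le> h y - c * t" if "t > 0" for t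
          using dS[OF True] that mult_left_mono[of "a \<bullet> d" "-c" t]
          by (auto simp: S_def inner_add_right mult.commute)
        then show ?thesis
          by (auto simp: eventually_at_right_field intro!: exI[of _ 1])
      next
        case False
        then have "a \<bullet> y - b < h y" using ab h_ge[OF ab, of y] by (auto simp: S_def)
        moreover have "((\<lambda>t. h y - c * t - (a \<bullet> (y + t *\<^sub>R d) - b))
            \<longlongrightarrow> h y - c * 0 - (a \<bullet> (y + 0 *\<^sub>R d) - b)) (at_right 0)"
          by (intro tendsto_intros)
        ultimately have "eventually (\<lambda>t. 0 < h y - c * t - (a \<bullet> (y + t *\<^sub>R d) - b)) (at_right 0)"
          by (intro order_tendstoD) auto
        then show ?thesis by eventually_elim simp
      qed
      have "eventually (\<lambda>t. \<forall>p\<in>A. fst p \<bullet> (y + t *\<^sub>R d) - snd p \<le> h y - c * t) (at_right 0)"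
        using fin ev by (intro eventually_ball_finite) auto
      \<comment> \<open>Staying below \<open>h y / c\<close> keeps \<open>h y - c * t\<close>
        nonnegative, as \<open>h_le\<close> demands of an upper bound for \<open>h\<close>.\<close>
      moreover have "eventually (\<lambda>t. 0 < t \<and> t < h y / c) (at_right 0)"
        using hy c_pos by (auto simp: eventually_at_right_field intro!: exI[of _ "h y / c"])
      ultimately have "eventually (\<lambda>t. 0 < t \<and> t < h y / c \<and>
          (\<forall>p\<in>A. fst p \<bullet> (y + t *\<^sub>R d) - snd p \<le> h y - c * t)) (at_right 0)"
        by eventually_elim auto
      then obtain t where t: "0 < t" "t < h y / c"
        "\<forall>p\<in>A. fst p \<bullet> (y + t *\<^sub>R d) - snd p \<le> h y - c * t"
        using eventually_happens' trivial_limit_at_right_real by (metis (no_types, lifting))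
      have "h (y + t *\<^sub>R d) \<le> h y - c * t"
        using t c_pos by (intro h_le) (auto simp: field_simps)
      moreover have "norm (x - (y + t *\<^sub>R d)) \<le> norm (x - y) + t"
        using norm_triangle_ineq4[of "x - y" "t *\<^sub>R d"] nd t(1) by (simp add: algebra_simps)
      then have "e * norm (x - (y + t *\<^sub>R d)) \<le> e * (norm (x - y) + t)"
        using e by (intro mult_left_mono) auto
      ultimately have "c * t \<le> e * t"
        using glob[of "y + t *\<^sub>R d"] by (simp add: algebra_simps)
      with t e show False by simp
    qed
    with y show ?thesis by (auto simp: dist_norm)
  qed
  show thesis
  proof (rule that[of "1 / e"])
    show "1 / e > 0" using e by simp
    fix x assume "\<exists>(a, b)\<in>A. a \<bullet> x > b"
    then have hx: "h x > 0" using h_ge[of _ _ x] by force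
    obtain y where y: "h y = 0" "norm (x - y) \<le> h x / e" using main by blast
    from h_attain[OF hx] obtain a b where "(a, b) \<in> A" "h x = a \<bullet> x - b" by auto
    moreover have "\<forall>(a, b)\<in>A. a \<bullet> y \<le> b" using h_ge[of _ _ y] y(1) by force
    ultimately show "\<exists>y. (\<forall>(a, b)\<in>A. a \<bullet> y \<le> b) \<and>
        (\<exists>(a, b)\<in>A. norm (x - y) \<le> 1 / e * (a \<bullet> x - b))"
      using y(2) by (intro exI[of _ y]) force
  qed
qed

lemma polyhedron_inequalities:
  fixes P :: "'a::euclidean_space set"
  assumes "polyhedron P"
  obtains A where "finite A" "P = {x. \<forall>(a, b)\<in>A. a \<bullet> x \<le> b}"
proof -
  obtain F where F: "finite F" "P = \<Inter>F"
    "\<And>H. H \<in> F \<Longrightarrow> \<exists>a b. a \<noteq> 0 \<and> H = {x. a \<bullet> x \<le> b}"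
    using assms unfolding polyhedron_def by blast
  then obtain \<alpha> \<beta> where ab: "\<And>H. H \<in> F \<Longrightarrow> H = {x. \<alpha> H \<bullet> x \<le> \<beta> H}" by metis
  have "P = {x. \<forall>(a, b)\<in>(\<lambda>H. (\<alpha> H, \<beta> H)) ` F. a \<bullet> x \<le> b}"
    using ab F(2) by auto
  then show thesis by (rule that[OF finite_imageI[OF F(1)]])
qed

section \<open>Lipschitz estimates with linearly growing constants\<close>

lemma quadratic_fun_lipschitz:
  assumes "quadratic_fun q"
  obtains B where "B \<ge> 0" "\<And>x y. \<bar>q x - q y\<bar> \<le> B * (1 + norm x + norm y) * norm (x - y)"
proof -
  obtain A b c where q: "\<And>x. q x = x \<bullet> (A *v x) + b \<bullet> x + c"
    using assms unfolding quadratic_fun_def by blast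
  obtain K where K: "K > 0" "\<And>x. norm (A *v x) \<le> norm x * K"
    using bounded_linear.pos_bounded[OF matrix_vector_mul_bounded_linear[of A]] by blast
  show thesis
  proof (rule that[of "K + norm b"])
    show "K + norm b \<ge> 0" using K by simp
    fix x y
    \<comment> \<open>The bilinear form is changed in one argument at a time, which is an identity
      for any matrix.\<close>
    have "q x - q y = (x - y) \<bullet> (A *v x) + y \<bullet> (A *v (x - y)) + b \<bullet> (x - y)"
      by (simp add: q algebra_simps matrix_vector_mult_diff_distrib)
    also have "\<bar>\<dots>\<bar> \<le> \<bar>(x - y) \<bullet> (A *v x)\<bar> + \<bar>y \<bullet> (A *v (x - y))\<bar> + \<bar>b \<bullet> (x - y)\<bar>"
      by linarith
    also have "\<bar>(x - y) \<bullet> (A *v x)\<bar> \<le> norm (x - y) * (norm x * K)"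
      using Cauchy_Schwarz_ineq2[of "x - y" "A *v x"] mult_left_mono[OF K(2)[of x], of "norm (x - y)"]
      by auto
    also have "\<bar>y \<bullet> (A *v (x - y))\<bar> \<le> norm y * (norm (x - y) * K)"
      using Cauchy_Schwarz_ineq2[of y "A *v (x - y)"] mult_left_mono[OF K(2)[of "x - y"], of "norm y"]
      by auto
    also have "\<bar>b \<bullet> (x - y)\<bar> \<le> norm b * norm (x - y)"
      by (rule Cauchy_Schwarz_ineq2)
    also have "norm (x - y) * (norm x * K) + norm y * (norm (x - y) * K) + norm b * norm (x - y)
        = (K * (norm x + norm y) + norm b) * norm (x - y)"
      by (simp add: algebra_simps)
    also have "\<dots> \<le> ((K + norm b) * (1 + norm x + norm y)) * norm (x - y)"
    proof (rule mult_right_mono)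
      have "0 \<le> K + norm b * (norm x + norm y)" using K by simp
      then show "K * (norm x + norm y) + norm b \<le> (K + norm b) * (1 + norm x + norm y)"
        by (simp add: algebra_simps)
    qed simp
    finally show "\<bar>q x - q y\<bar> \<le> (K + norm b) * (1 + norm x + norm y) * norm (x - y)"
      by simp
  qed
qed

text \<open>Convexity keeps the segment from \<open>y\<close> to \<open>x\<close> inside
  \<open>D\<close>. The closed pieces cut its parameter interval into finitely many closed sets, on
  each of which \<open>f\<close> inherits the estimate of one quadratic; Lipschitz bounds with a
  common constant glue over such a cover.\<close>

lemma piecewise_quadratic_lipschitz:
  fixes f :: "real ^ 'n \<Rightarrow> real"
  assumes D: "convex D" "D = (\<Union>i\<in>J. P i)" and J: "finite J"
    and cl: "\<And>i. i \<in> J \<Longrightarrow> closed (P i)"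
    and q: "\<And>i. i \<in> J \<Longrightarrow> quadratic_fun (q i)"
    and f: "\<And>i x. i \<in> J \<Longrightarrow> x \<in> P i \<Longrightarrow> f x = q i x"
  obtains L where "L \<ge> 0"
    "\<And>x y. x \<in> D \<Longrightarrow> y \<in> D \<Longrightarrow> \<bar>f x - f y\<bar> \<le> L * (1 + norm x + norm y) * norm (x - y)"
proof -
  have "\<exists>B\<ge>0. \<forall>x y. \<bar>q i x - q i y\<bar> \<le> B * (1 + norm x + norm y) * norm (x - y)"
    if "i \<in> J" for i
    using quadratic_fun_lipschitz[OF q[OF that]] by metis
  then obtain B where B0: "\<And>i. i \<in> J \<Longrightarrow> B i \<ge> 0" and B: "\<And>i x y. i \<in> J \<Longrightarrow>
      \<bar>q i x - q i y\<bar> \<le> B i * (1 + norm x + norm y) * norm (x - y)"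
    by metis
  define L where "L = sum B J"
  have L0: "L \<ge> 0" unfolding L_def using B0 by (simp add: sum_nonneg)
  have BL: "B i \<le> L" if "i \<in> J" for i
    unfolding L_def using that J B0 by (intro member_le_sum) auto
  show thesis
  \<comment> \<open>The factor 2 arises because both points compared on the segment have norm at
    most \<open>norm x + norm y\<close>.\<close>
  proof (rule that[of "2 * L"])
    show "2 * L \<ge> 0" using L0 by simp
    fix x y assume x: "x \<in> D" and y: "y \<in> D"
    define \<gamma> where "\<gamma> t = (1 - t) *\<^sub>R y + t *\<^sub>R x" for t :: real
    define N where "N = norm x + norm y"
    have N0: "N \<ge> 0" by (simp add: N_def)
    have \<gamma>D: "\<gamma> t \<in> D" if "t \<in> {0..1}" for t
      using D(1) x y that unfolding \<gamma>_def by (intro convexD) auto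
    have \<gamma>N: "norm (\<gamma> t) \<le> N" if "t \<in> {0..1}" for t
    proof -
      have "norm (\<gamma> t) \<le> (1 - t) * norm y + t * norm x"
        unfolding \<gamma>_def using that by (intro order_trans[OF norm_triangle_ineq]) auto
      also have "\<dots> \<le> 1 * norm y + 1 * norm x"
        using that by (intro add_mono mult_right_mono) auto
      finally show ?thesis by (simp add: N_def)
    qed
    define K where "K = 2 * L * (1 + N) * norm (x - y)"
    have K0: "K \<ge> 0" unfolding K_def using L0 N0 by simp
    define U where "U i = {0..1} \<inter> \<gamma> -` P i" for i
    have clU: "closed (U i)" if "i \<in> J" for i
      unfolding U_def using cl[OF that] unfolding \<gamma>_def
      by (intro continuous_closed_preimage continuous_intros) auto
    have lipU: "K-lipschitz_on (U i) (\<lambda>t. f (\<gamma> t))" if i: "i \<in> J" for i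
    proof (rule lipschitz_onI)
      fix s t assume s: "s \<in> U i" and t: "t \<in> U i"
      then have st: "s \<in> {0..1}" "t \<in> {0..1}" by (auto simp: U_def)
      have diff: "\<gamma> s - \<gamma> t = (s - t) *\<^sub>R (x - y)" by (simp add: \<gamma>_def algebra_simps)
      have "dist (f (\<gamma> s)) (f (\<gamma> t)) = \<bar>q i (\<gamma> s) - q i (\<gamma> t)\<bar>"
        using s t f[OF i] by (auto simp: U_def dist_real_def)
      also have "\<dots> \<le> B i * (1 + norm (\<gamma> s) + norm (\<gamma> t)) * norm (\<gamma> s - \<gamma> t)"
        by (rule B[OF i])
      also have "\<dots> \<le> L * (2 * (1 + N)) * norm (\<gamma> s - \<gamma> t)"
        using \<gamma>N[OF st(1)] \<gamma>N[OF st(2)] BL[OF i] L0 by (intro mult_right_mono mult_mono) auto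
      also have "\<dots> = K * dist s t"
        unfolding diff by (simp add: K_def dist_real_def)
      finally show "dist (f (\<gamma> s)) (f (\<gamma> t)) \<le> K * dist s t" .
    qed (rule K0)
    have "K-lipschitz_on {0..1} (\<lambda>t. f (\<gamma> t))"
      using \<gamma>D D(2) by (intro lipschitz_on_closed_Union[OF lipU clU J K0]) (auto simp: U_def)
    then have "dist (f (\<gamma> 1)) (f (\<gamma> 0)) \<le> K * dist (1::real) 0"
      by (rule lipschitz_onD) auto
    then show "\<bar>f x - f y\<bar> \<le> 2 * L * (1 + norm x + norm y) * norm (x - y)"
      by (simp add: \<gamma>_def K_def N_def dist_real_def add.assoc)
  qed
qed

section \<open>Affine substitutes for the norm, and differences of squares\<close>

text \<open>Squares of affine functions cannot contain \<open>norm x\<close> itself. The largest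
  coordinate of \<open>x\<close> is at least \<open>norm x\<close> divided by the dimension, and
  taking both signs of each basis vector replaces its absolute value by an affine function.\<close>

lemma finite_affine_norm_bound:
  obtains U :: "('a::euclidean_space) set" and c :: real where "finite U" "c > 0"
    "\<And>x. \<exists>u\<in>U. u \<bullet> x + 1 \<ge> c * (1 + norm x)"
proof (rule that[of "Basis \<union> uminus ` Basis" "1 / real DIM('a)"])
  fix x :: 'a
  let ?n = "real DIM('a)"
  have n: "?n \<ge> 1" using DIM_positive[where 'a='a] by linarith
  have "\<exists>b\<in>Basis. norm x \<le> ?n * \<bar>x \<bullet> b\<bar>"
  proof (rule ccontr)
    assume "\<not> ?thesis"
    then have "(\<Sum>b\<in>Basis. \<bar>x \<bullet> b\<bar>) < (\<Sum>b\<in>(Basis::'a set). norm x / ?n)"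
      using n by (intro sum_strict_mono) (auto simp: field_simps not_le)
    also have "\<dots> = norm x" by simp
    finally show False using norm_le_l1[of x] by simp
  qed
  then obtain b where b: "b \<in> Basis" "norm x \<le> ?n * \<bar>x \<bullet> b\<bar>" by blast
  have *: "1 / ?n * (1 + norm x) \<le> \<bar>x \<bullet> b\<bar> + 1"
  proof -
    have "1 + norm x \<le> (\<bar>x \<bullet> b\<bar> + 1) * ?n"
      using add_mono[OF n b(2)] by (simp add: algebra_simps)
    then show ?thesis by (simp add: pos_divide_le_eq)
  qed
  show "\<exists>u\<in>Basis \<union> uminus ` Basis. u \<bullet> x + 1 \<ge> 1 / ?n * (1 + norm x)"
  proof (cases "x \<bullet> b \<ge> 0")
    case True
    with * b(1) show ?thesis by (intro bexI[of _ b]) (auto simp: inner_commute)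
  next
    case False
    with * b(1) show ?thesis by (intro bexI[of _ "- b"]) (auto simp: inner_commute)
  qed
qed auto

text \<open>The witnesses are explicit arguments here so that they can later be chosen as functions
  of the indices i and k.\<close>

definition sq_difference_repr ::
    "(real ^ 'n \<Rightarrow> real) \<Rightarrow> nat \<Rightarrow> nat \<Rightarrow> (nat \<Rightarrow> real ^ 'n \<Rightarrow> real) \<Rightarrow> (nat \<Rightarrow> real ^ 'n \<Rightarrow> real) \<Rightarrow> bool" where
  "sq_difference_repr g Jp Jm fp fm \<longleftrightarrow>
     (\<forall>j\<in>{1..Jp}. fp j \<in> sq_affine_family) \<and> (\<forall>j\<in>{1..Jm}. fm j \<in> sq_affine_family) \<and>
     (\<forall>x. g x = (\<Sum>j=1..Jp. fp j x) - (\<Sum>j=1..Jm. fm j x))"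

definition sq_difference :: "(real ^ 'n \<Rightarrow> real) \<Rightarrow> bool" where
  "sq_difference g \<longleftrightarrow> (\<exists>Jp Jm fp fm. sq_difference_repr g Jp Jm fp fm)"

lemma sq_difference_zero: "sq_difference (\<lambda>x. 0)"
  unfolding sq_difference_def sq_difference_repr_def
  by (intro exI[of _ 0]) auto

lemma sq_difference_pos: "g \<in> sq_affine_family \<Longrightarrow> sq_difference g"
  unfolding sq_difference_def sq_difference_repr_def
  by (intro exI[of _ 1] exI[of _ 0] exI[of _ "\<lambda>_. g"]) auto

lemma sq_difference_diff:
  "g \<in> sq_affine_family \<Longrightarrow> h \<in> sq_affine_family \<Longrightarrow> sq_difference (\<lambda>x. g x - h x)"
  unfolding sq_difference_def sq_difference_repr_def
  by (intro exI[of _ 1] exI[of _ "\<lambda>_. g"] exI[of _ "\<lambda>_. h"]) auto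

lemma max_affine_sq_in_family: "(\<lambda>x. (max (a \<bullet> x + \<alpha>) 0)\<^sup>2) \<in> sq_affine_family"
  unfolding sq_affine_family_def by blast

section \<open>The penalty for a single piece\<close>

text \<open>Each piece is handled separately, as an unindexed finite set of functions. Domination of
  \<open>f - q\<close> on \<open>D\<close> ensures that this piece never pulls the minimum below
  \<open>f\<close>.\<close>

lemma exists_penalty:
  fixes f q :: "real ^ 'n \<Rightarrow> real"
  assumes P: "polyhedron P" "P \<subseteq> D" and q: "quadratic_fun q" and fq: "\<And>x. x \<in> P \<Longrightarrow> f x = q x"
    and L0: "L \<ge> 0" and L: "\<And>x y. x \<in> D \<Longrightarrow> y \<in> D \<Longrightarrow>
      \<bar>f x - f y\<bar> \<le> L * (1 + norm x + norm y) * norm (x - y)"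
  obtains G where "finite G" "G \<noteq> {}" "\<And>g. g \<in> G \<Longrightarrow> sq_difference g"
    "{x. (MAX g\<in>G. g x) = 0} = P" "\<And>x. x \<in> D \<Longrightarrow> f x \<le> q x + (MAX g\<in>G. g x)"
proof -
  obtain U :: "(real ^ 'n) set" and c where U: "finite U" "c > 0"
    "\<And>x. \<exists>u\<in>U. u \<bullet> x + 1 \<ge> c * (1 + norm x)"
    by (rule finite_affine_norm_bound) blast
  obtain B where B0: "B \<ge> 0"
    and B: "\<And>x y. \<bar>q x - q y\<bar> \<le> B * (1 + norm x + norm y) * norm (x - y)"
    by (rule quadratic_fun_lipschitz[OF q]) blast
  define E where "E = L + B"
  have E0: "E \<ge> 0" using L0 B0 by (simp add: E_def)
  have E: "f x - q x \<le> f y - q y + E * (1 + norm x + norm y) * norm (x - y)"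
    if "x \<in> D" "y \<in> D" for x y
    using L[OF that] B[of x y] by (simp add: E_def algebra_simps)
  show thesis
  proof (cases "P = {}")
    case True
    show thesis
    proof (cases "D = {}")
      case True
      with \<open>P = {}\<close> show thesis
        using that[of "{\<lambda>x. (max (0 \<bullet> x + 1) 0)\<^sup>2}"] sq_difference_pos[OF max_affine_sq_in_family[of 0 1]]
        by simp
    next
      case False
      then obtain y where y: "y \<in> D" by blast
      define m where "m = 1 + norm y"
      \<comment> \<open>The first term absorbs the value at the reference point \<open>y\<close>,
        the second the Lipschitz growth away from it; the 1 gives
        \<open>M \<le> M\<^sup>2\<close>.\<close>
      define M where "M = \<bar>f y - q y\<bar> + E * m\<^sup>2 + 1"
      have m: "m \<ge> 1" by (simp add: m_def)
      have M: "M \<ge> 1" using E0 by (simp add: M_def)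
      have bound: "f x - q x \<le> (M * (1 + norm x))\<^sup>2" if "x \<in> D" for x
      proof -
        let ?r = "1 + norm x"
        have r: "?r \<ge> 1" by simp
        have "m * ?r = 1 + norm x + norm y + norm x * norm y"
          by (simp add: m_def algebra_simps)
        moreover have "0 \<le> norm x * norm y" by simp
        ultimately have le: "1 + norm x + norm y \<le> m * ?r" "norm (x - y) \<le> m * ?r"
          using norm_triangle_ineq4[of x y] by linarith+
        have "E * (1 + norm x + norm y) * norm (x - y) \<le> E * (m * ?r) * (m * ?r)"
          using le E0 m r by (intro mult_mono mult_left_mono mult_nonneg_nonneg) auto
        also have "\<dots> = E * m\<^sup>2 * ?r\<^sup>2" by (simp add: power2_eq_square)
        finally have "E * (1 + norm x + norm y) * norm (x - y) \<le> E * m\<^sup>2 * ?r\<^sup>2" .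
        moreover have "\<bar>f y - q y\<bar> \<le> \<bar>f y - q y\<bar> * ?r\<^sup>2"
          using one_le_power[OF r, of 2] by (simp add: mult_le_cancel_left1)
        ultimately have "f x - q x \<le> \<bar>f y - q y\<bar> * ?r\<^sup>2 + E * m\<^sup>2 * ?r\<^sup>2"
          using E[OF that y] abs_ge_self[of "f y - q y"] by linarith
        also have "\<dots> \<le> M * ?r\<^sup>2" by (simp add: M_def distrib_right)
        also have "\<dots> \<le> M\<^sup>2 * ?r\<^sup>2"
          using M by (intro mult_right_mono) (auto simp: power2_eq_square)
        finally show ?thesis by (simp add: power_mult_distrib)
      qed
      \<comment> \<open>Dividing by \<open>c\<close> cancels the loss in
        \<open>u \<bullet> x + 1 \<ge> c * (1 + norm x)\<close>.\<close>
      define g where "g u = (\<lambda>x. (max ((M / c) *\<^sub>R u \<bullet> x + M / c) 0)\<^sup>2)" for u :: "real ^ 'n"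
      have ge: "(MAX g\<in>g ` U. g x) \<ge> (M * (1 + norm x))\<^sup>2" for x
      proof -
        obtain u where u: "u \<in> U" "u \<bullet> x + 1 \<ge> c * (1 + norm x)" using U(3) by blast
        have "M * (1 + norm x) = M / c * (c * (1 + norm x))" using U(2) by simp
        also have "\<dots> \<le> M / c * (u \<bullet> x + 1)"
          using u(2) M U(2) by (intro mult_left_mono) auto
        finally have "M * (1 + norm x) \<le> max ((M / c) *\<^sub>R u \<bullet> x + M / c) 0"
          by (simp add: algebra_simps)
        then have "(M * (1 + norm x))\<^sup>2 \<le> g u x"
          unfolding g_def using M by (intro power_mono) auto
        also have "\<dots> \<le> (MAX g\<in>g ` U. g x)"
          using U(1) u(1) by (intro Max_ge) auto
        finally show ?thesis .
      qed
      have pos: "(M * (1 + norm x))\<^sup>2 > 0" for x :: "real ^ 'n"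
      proof -
        have "1 + norm x > 0" by (rule add_pos_nonneg) auto
        with M show ?thesis by simp
      qed
      show thesis
      proof (rule that[of "g ` U"])
        show "g ` U \<noteq> {}" using U(3)[of 0] by auto
        show "sq_difference h" if "h \<in> g ` U" for h
          using that sq_difference_pos[OF max_affine_sq_in_family] unfolding g_def by blast
        show "{x. (MAX g\<in>g ` U. g x) = 0} = P"
        proof -
          have "(MAX g\<in>g ` U. g x) \<noteq> 0" for x
            using ge[of x] pos[of x] by linarith
          then show ?thesis unfolding True by blast
        qed
        show "f x \<le> q x + (MAX g\<in>g ` U. g x)" if "x \<in> D" for x
          using bound[OF that] ge[of x] by linarith
      qed (use U in auto)
    qed
  next
    case False
    then obtain z where z: "z \<in> P" by blast
    obtain A where A: "finite A" "P = {x. \<forall>(a, b)\<in>A. a \<bullet> x \<le> b}"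
      using polyhedron_inequalities[OF P(1)] by blast
    obtain C where C: "C > 0" "\<And>x. \<exists>(a, b)\<in>A. a \<bullet> x > b \<Longrightarrow>
       \<exists>y. (\<forall>(a, b)\<in>A. a \<bullet> y \<le> b) \<and> (\<exists>(a, b)\<in>A. norm (x - y) \<le> C * (a \<bullet> x - b))"
      using Hoffman_error_bound[OF A(1), of z] z A(2) by blast
    \<comment> \<open>Chosen for the two coefficient comparisons \<open>M * c \<ge> E * C\<close>
      (terms linear in the violation) and \<open>M\<^sup>2 \<ge> E * C\<^sup>2\<close> (quadratic
      terms); the 1 gives \<open>M \<ge> 1\<close>.\<close>
    define M where "M = E * C / c + E * C\<^sup>2 + 1"
    have EC: "0 \<le> E * C / c" "0 \<le> E * C\<^sup>2" using E0 C(1) U(2) by auto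
    have M: "M \<ge> 1" "M \<ge> E * C\<^sup>2" using EC unfolding M_def by linarith+
    have "M * c = E * C + (E * C\<^sup>2 + 1) * c" using U(2) by (simp add: M_def distrib_right)
    moreover have "(E * C\<^sup>2 + 1) * c \<ge> 0" using EC(2) U(2) by (intro mult_nonneg_nonneg) auto
    ultimately have Mc: "M * c \<ge> E * C" by linarith
    have M2: "M\<^sup>2 \<ge> E * C\<^sup>2"
      using M by (intro order_trans[OF M(2)]) (auto simp: power2_eq_square)
    define g where "g p = (case p of (u, a, b) \<Rightarrow> (\<lambda>x.
        (max ((u + M *\<^sub>R a) \<bullet> x + (1 - M * b)) 0)\<^sup>2 - (max (u \<bullet> x + 1) 0)\<^sup>2))"
      for p :: "(real ^ 'n) \<times> (real ^ 'n) \<times> real"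
    \<comment> \<open>The zero function lifts the maximum to 0 on \<open>P\<close>, where the other
      members are nonpositive, and keeps \<open>G\<close> nonempty if there are no
      constraints.\<close>
    define G where "G = insert (\<lambda>x. 0) (g ` (U \<times> A))"
    have finG: "finite G" using U(1) A(1) by (simp add: G_def)
    have Max0: "(MAX h\<in>G. h x) \<ge> 0" for x
      using finG by (intro Max_ge) (auto simp: G_def)
    have in_P: "(MAX h\<in>G. h x) = 0" if "x \<in> P" for x
    proof (rule antisym[OF _ Max0])
      have "g (u, a, b) x \<le> 0" if "(a, b) \<in> A" for u a b
      proof -
        have "M * (a \<bullet> x) \<le> M * b"
          using that \<open>x \<in> P\<close> M(1) A(2) by (intro mult_left_mono) auto
        then have "max ((u + M *\<^sub>R a) \<bullet> x + (1 - M * b)) 0 \<le> max (u \<bullet> x + 1) 0"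
          by (simp add: inner_add_left)
        then show ?thesis unfolding g_def by (simp add: power_mono)
      qed
      then show "(MAX h\<in>G. h x) \<le> 0"
        using finG by (subst Max_le_iff) (auto simp: G_def)
    qed
    have ge: "(MAX h\<in>G. h x) \<ge> 2 * M * c * (1 + norm x) * (a \<bullet> x - b) + M\<^sup>2 * (a \<bullet> x - b)\<^sup>2"
      if ab: "(a, b) \<in> A" "a \<bullet> x - b \<ge> 0" for a b x
    proof -
      let ?l = "a \<bullet> x - b"
      obtain u where u: "u \<in> U" "u \<bullet> x + 1 \<ge> c * (1 + norm x)" using U(3) by blast
      \<comment> \<open>Nonnegativity of \<open>u \<bullet> x + 1\<close> and of
        \<open>M * ?l\<close> removes both truncations, leaving a difference of squares to
        expand.\<close>
      have u0: "u \<bullet> x + 1 \<ge> 0" using u(2) U(2) by (smt (verit) norm_ge_zero mult_nonneg_nonneg)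
      have Ml: "M * ?l \<ge> 0" using ab M(1) by simp
      have eq: "(u + M *\<^sub>R a) \<bullet> x + (1 - M * b) = (u \<bullet> x + 1) + M * ?l"
        by (simp add: inner_add_left algebra_simps)
      have "g (u, a, b) x = ((u \<bullet> x + 1) + M * ?l)\<^sup>2 - (u \<bullet> x + 1)\<^sup>2"
        unfolding g_def prod.case eq using u0 Ml by (simp add: max_absorb1 del: diff_ge_0_iff_ge)
      also have "\<dots> = 2 * M * (u \<bullet> x + 1) * ?l + M\<^sup>2 * ?l\<^sup>2"
        by (simp add: power2_eq_square algebra_simps)
      finally have "g (u, a, b) x = 2 * M * (u \<bullet> x + 1) * ?l + M\<^sup>2 * ?l\<^sup>2" .
      moreover have "2 * M * (c * (1 + norm x)) * ?l \<le> 2 * M * (u \<bullet> x + 1) * ?l"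
        using u(2) M(1) ab(2) by (intro mult_right_mono mult_left_mono) auto
      moreover have "g (u, a, b) x \<le> (MAX h\<in>G. h x)"
        using finG u(1) ab(1) by (intro Max_ge) (auto simp: G_def)
      ultimately show ?thesis by (simp add: mult.assoc)
    qed
    have zero_set: "{x. (MAX h\<in>G. h x) = 0} = P"
    proof (intro set_eqI iffI)
      fix x assume x0: "x \<in> {x. (MAX h\<in>G. h x) = 0}"
      show "x \<in> P"
      proof (rule ccontr)
        assume "x \<notin> P"
        then obtain a b where ab: "(a, b) \<in> A" "a \<bullet> x - b > 0" using A(2) by auto
        then have "0 < M\<^sup>2 * (a \<bullet> x - b)\<^sup>2" using M(1) by simp
        moreover have "0 \<le> 2 * M * c * (1 + norm x) * (a \<bullet> x - b)"
          using ab M(1) U(2) by (intro mult_nonneg_nonneg) auto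
        ultimately show False using ge[OF ab(1), of x] ab(2) x0 by simp
      qed
    qed (use in_P in auto)
    have bound: "f x \<le> q x + (MAX h\<in>G. h x)" if x: "x \<in> D" for x
    proof (cases "x \<in> P")
      case True
      then show ?thesis using fq Max0[of x] by simp
    next
      case False
      then have "\<exists>(a, b)\<in>A. a \<bullet> x > b" using A(2) by force
      from C(2)[OF this] obtain y a b where y: "y \<in> P" and ab: "(a, b) \<in> A"
        and d: "norm (x - y) \<le> C * (a \<bullet> x - b)" using A(2) by auto
      define l where "l = a \<bullet> x - b"
      have d: "norm (x - y) \<le> C * l" using d by (simp add: l_def)
      \<comment> \<open>The constraint returned by Hoffman's bound is not stated to be violated; its
        sign follows from the norm estimate.\<close>
      then have "0 \<le> C * l" using norm_ge_zero[of "x - y"] by linarith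
      then have l: "l \<ge> 0" using C(1) by (simp add: zero_le_mult_iff)
      have ny: "norm y \<le> norm x + C * l" using norm_triangle_sub[of y x] d
        by (simp add: norm_minus_commute)
      \<comment> \<open>At \<open>y\<close> in \<open>P\<close> the difference
        \<open>f y - q y\<close> vanishes, so only the Lipschitz term remains.\<close>
      have "f x - q x \<le> E * (1 + norm x + norm y) * norm (x - y)"
        using E[OF x, of y] y P(2) fq[OF y] by auto
      also have "\<dots> \<le> E * (2 * (1 + norm x) + C * l) * (C * l)"
        using ny d E0 l C(1) by (intro mult_mono mult_left_mono mult_nonneg_nonneg) auto
      also have "\<dots> = 2 * (E * C) * ((1 + norm x) * l) + E * C\<^sup>2 * l\<^sup>2"
        by (simp add: power2_eq_square algebra_simps)
      also have "\<dots> \<le> 2 * (M * c) * ((1 + norm x) * l) + M\<^sup>2 * l\<^sup>2"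
        using Mc M2 l by (intro add_mono mult_right_mono mult_left_mono) auto
      also have "\<dots> \<le> (MAX h\<in>G. h x)"
        using ge[OF ab, of x] l by (simp add: l_def mult.assoc)
      finally show ?thesis by simp
    qed
    show thesis
    proof (rule that[OF finG _ _ zero_set bound])
      show "G \<noteq> {}" by (simp add: G_def)
      show "sq_difference h" if "h \<in> G" for h
      proof -
        from that consider "h = (\<lambda>x. 0)" | u a b where "h = g (u, a, b)"
          unfolding G_def by auto
        then show ?thesis
          using sq_difference_zero
            sq_difference_diff[OF max_affine_sq_in_family max_affine_sq_in_family]
          unfolding g_def by cases simp_all
      qed
    qed
  qed
qed

section \<open>Assembling the min-max formula\<close>

theorem proposition7:
  fixes f :: "real ^ 'n \<Rightarrow> real" and D :: "(real ^ 'n) set"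
    and I :: nat and P :: "nat \<Rightarrow> (real ^ 'n) set" and q :: "nat \<Rightarrow> real ^ 'n \<Rightarrow> real"
  assumes "plq_on D f"
    and "polyhedron D"
    and "D = (\<Union>i\<in>{1..I}. P i)"
    and "\<And>i. i \<in> {1..I} \<Longrightarrow> polyhedron (P i)"
    and "\<And>i. i \<in> {1..I} \<Longrightarrow> quadratic_fun (q i)"
    and "\<And>i x. i \<in> {1..I} \<Longrightarrow> x \<in> P i \<Longrightarrow> f x = q i x"
  shows "\<exists>(K :: nat \<Rightarrow> nat) (Jp :: nat \<Rightarrow> nat \<Rightarrow> nat) (Jm :: nat \<Rightarrow> nat \<Rightarrow> nat)
            (fp :: nat \<Rightarrow> nat \<Rightarrow> nat \<Rightarrow> real ^ 'n \<Rightarrow> real)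
            (fm :: nat \<Rightarrow> nat \<Rightarrow> nat \<Rightarrow> real ^ 'n \<Rightarrow> real)
            (fk :: nat \<Rightarrow> nat \<Rightarrow> real ^ 'n \<Rightarrow> real).
      (\<forall>i\<in>{1..I}. K i \<ge> 1) \<and>
      (\<forall>i\<in>{1..I}. \<forall>k\<in>{1..K i}.
          (\<forall>j\<in>{1..Jp i k}. fp i k j \<in> sq_affine_family) \<and>
          (\<forall>j\<in>{1..Jm i k}. fm i k j \<in> sq_affine_family) \<and>
          (\<forall>x. fk i k x = (\<Sum>j=1..Jp i k. fp i k j x) - (\<Sum>j=1..Jm i k. fm i k j x))) \<and>
      (\<forall>x\<in>D. f x = (MIN i\<in>{1..I}. q i x + (MAX k\<in>{1..K i}. fk i k x))) \<and>
      (\<forall>i\<in>{1..I}. {x. (MAX k\<in>{1..K i}. fk i k x) = 0} = P i)"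
proof -
  have closed: "closed (P i)" if "i \<in> {1..I}" for i
    using assms(4)[OF that] by (rule polyhedron_imp_closed)
  obtain L where L: "L \<ge> 0" "\<And>x y. x \<in> D \<Longrightarrow> y \<in> D \<Longrightarrow>
      \<bar>f x - f y\<bar> \<le> L * (1 + norm x + norm y) * norm (x - y)"
    by (rule piecewise_quadratic_lipschitz[OF polyhedron_imp_convex[OF assms(2)] assms(3)
      finite_atLeastAtMost closed assms(5,6)]) blast+
  define good where "good i G \<longleftrightarrow> finite G \<and> G \<noteq> {} \<and> (\<forall>g\<in>G. sq_difference g) \<and>
      {x. (MAX g\<in>G. g x) = 0} = P i \<and> (\<forall>x\<in>D. f x \<le> q i x + (MAX g\<in>G. g x))" for i G
  have "\<exists>G. good i G" if i: "i \<in> {1..I}" for i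
  proof -
    have "P i \<subseteq> D" using assms(3) i by blast
    then show ?thesis
      by (rule exists_penalty[OF assms(4)[OF i] _ assms(5)[OF i] assms(6)[OF i] L])
        (unfold good_def, blast+)
  qed
  then obtain G where good: "\<And>i. i \<in> {1..I} \<Longrightarrow> good i (G i)" by metis
  have G: "finite (G i)" "G i \<noteq> {}" "\<And>g. g \<in> G i \<Longrightarrow> sq_difference g"
    "{x. (MAX g\<in>G i. g x) = 0} = P i" "\<And>x. x \<in> D \<Longrightarrow> f x \<le> q i x + (MAX g\<in>G i. g x)"
    if "i \<in> {1..I}" for i
    using good[OF that] unfolding good_def by blast+
  \<comment> \<open>Each \<open>G i\<close> is enumerated from 1 to match the index ranges; its
    nonemptiness gives \<open>K i \<ge> 1\<close>.\<close>
  have "\<exists>e. bij_betw e {1..card (G i)} (G i)" if "i \<in> {1..I}" for i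
    using ex_bij_betw_nat_finite_1[OF G(1)[OF that]] by blast
  then obtain fk where fk: "\<And>i. i \<in> {1..I} \<Longrightarrow> fk i ` {1..card (G i)} = G i"
    unfolding bij_betw_def by metis
  define K where "K i = card (G i)" for i
  have K: "K i \<ge> 1" if "i \<in> {1..I}" for i
    using G(1,2)[OF that] by (simp add: K_def Suc_le_eq card_gt_0_iff)
  have Max_eq: "(MAX k\<in>{1..K i}. fk i k x) = (MAX g\<in>G i. g x)" if "i \<in> {1..I}" for i x
  proof -
    have "(MAX k\<in>{1..K i}. fk i k x) = (MAX g\<in>fk i ` {1..card (G i)}. g x)"
      unfolding K_def image_image ..
    then show ?thesis unfolding fk[OF that] .
  qed
  have "\<exists>Jp Jm fp fm. sq_difference_repr (fk i k) Jp Jm fp fm" if "i \<in> {1..I}" "k \<in> {1..K i}" for i k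
  proof -
    have "fk i k \<in> G i" using fk[OF that(1)] that(2) unfolding K_def by blast
    then show ?thesis
      using G(3)[OF that(1)] unfolding sq_difference_def by blast
  qed
  then obtain Jp Jm fp fm where repr: "\<And>i k. i \<in> {1..I} \<Longrightarrow> k \<in> {1..K i} \<Longrightarrow>
      sq_difference_repr (fk i k) (Jp i k) (Jm i k) (fp i k) (fm i k)"
    by metis
  note J = repr[unfolded sq_difference_repr_def]
  \<comment> \<open>A piece containing \<open>x\<close> attains the value \<open>f x\<close> because
    its penalty is zero there; domination bounds every other branch from below.\<close>
  have min: "f x = (MIN i\<in>{1..I}. q i x + (MAX k\<in>{1..K i}. fk i k x))" if x: "x \<in> D" for x
  proof (rule Min_eqI[symmetric])
    obtain i where i: "i \<in> {1..I}" "x \<in> P i" using x assms(3) by blast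
    then have "(MAX k\<in>{1..K i}. fk i k x) = 0" using G(4)[OF i(1)] Max_eq[OF i(1)] by auto
    then have "f x = q i x + (MAX k\<in>{1..K i}. fk i k x)" using assms(6)[OF i] by simp
    with i(1) show "f x \<in> (\<lambda>i. q i x + (MAX k\<in>{1..K i}. fk i k x)) ` {1..I}"
      by blast
  next
    fix v assume "v \<in> (\<lambda>i. q i x + (MAX k\<in>{1..K i}. fk i k x)) ` {1..I}"
    then obtain i where i: "i \<in> {1..I}" "v = q i x + (MAX k\<in>{1..K i}. fk i k x)" by blast
    show "f x \<le> v" unfolding i(2) Max_eq[OF i(1)] by (rule G(5)[OF i(1) x])
  qed simp
  have zero_set: "{x. (MAX k\<in>{1..K i}. fk i k x) = 0} = P i" if "i \<in> {1..I}" for i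
    unfolding Max_eq[OF that] by (rule G(4)[OF that])
  show ?thesis
    by (intro exI[of _ K] exI[of _ Jp] exI[of _ Jm] exI[of _ fp] exI[of _ fm] exI[of _ fk]
        conjI[OF _ conjI[OF _ conjI]] ballI)
      (fact K J min zero_set)+
qed

end
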